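(* For any $k\geq 9$ and any admissible $v$ (that is, any $v$ such that a $(K_v,C_k)$-design exists), $$\left\{ n\geq v-\left\lfloor\frac{k-9}{4}\right\rfloor \;\Big|\; n\equiv 0,1\pmod 3\right\}\subseteq \mathcal{L}_2C_k(v)\subseteq\mathcal{L}_1C_k(v).$$
   Context: Graphs are finite and simple; $\Gamma'\leq\Gamma$ means that $\Gamma'$ is (isomorphic to) a subgraph of $\Gamma$. $K_n$ is the complete graph on $n$ vertices, $C_k$ is the cycle of length $k$, and $P_4$ is the path with $4$ vertices and $3$ edges. For graphs $\Gamma\leq K$, a $(K,\Gamma)$-design is a set of subgraphs of $K$, called blocks, each isomorphic to $\Gamma$, whose edge sets partition $E(K)$. A $(K_v,\Gamma)$-design is also called a $\Gamma$-design of order $v$. Given a $(K,\Gamma)$-design $\mathcal B$ and a $(K',\Gamma')$-design $\mathcal B'$ with $\Gamma'\leq\Gamma$, a down-link from $\mathcal B$ to $\mathcal B'$ is a function $f:\mathcal B\to\mathcal B'$ such that, for every $B\in\mathcal B$, $f(B)$ is a subgraph of $B$ (as an actual graph on the given vertices, not merely up to isomorphism). The complete graphs $K=K_v$ and $K'=K_n$ may have different vertex sets. When such an $f$ exists, $\mathcal B$ is said to be down-linked to $\mathcal B'$. Throughout, the target graph is $\Gamma'=P_4$. $\mathcal{L}_1\Gamma(v)$ is the set of all integers $n$ such that there exists some $\Gamma$-design of order $v$ that can be down-linked to some $P_4$-design of order $n$. $\mathcal{L}_2\Gamma(v)$ is the set of all integers $n$ such that every $\Gamma$-design of order $v$ can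 be down-linked to some $P_4$-design of order $n$. Here these are used with $\Gamma=C_k$. *)

theory Defs
  imports
    "HOL-Library.Disjoint_Sets"
    "HOL-Library.FuncSet"
    "HOL-Library.Infinite_Typeclass"
    Complex_Main
begin

record 'a sgraph =
  verts :: "'a set"
  edges :: "'a set set"

definition simple_graph :: "'a sgraph \<Rightarrow> bool" where
  "simple_graph G \<longleftrightarrow>
     finite (verts G) \<and> edges G \<subseteq> {e. e \<subseteq> verts G \<and> card e = 2}"

definition subgraph :: "'a sgraph \<Rightarrow> 'a sgraph \<Rightarrow> bool" where
  "subgraph H G \<longleftrightarrow>
     simple_graph H \<and> simple_graph G \<and> verts H \<subseteq> verts G \<and> edges H \<subseteq> edges G"

definition isomorphic :: "'a sgraph \<Rightarrow> 'b sgraph \<Rightarrow> bool" where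
  "isomorphic G H \<longleftrightarrow>
     simple_graph G \<and> simple_graph H \<and>
     (\<exists>\<phi>. bij_betw \<phi> (verts G) (verts H) \<and> edges H = (\<lambda>e. \<phi> ` e) ` edges G)"

text \<open>The relation \<open>H \<le> G\<close>: \<open>H\<close> is, up to isomorphism, a subgraph of \<open>G\<close>.\<close>

definition embeds_in :: "'b sgraph \<Rightarrow> 'a sgraph \<Rightarrow> bool" where
  "embeds_in H G \<longleftrightarrow> (\<exists>H'. subgraph H' G \<and> isomorphic H' H)"

definition complete_of_order :: "nat \<Rightarrow> 'a sgraph \<Rightarrow> bool" where
  "complete_of_order v K \<longleftrightarrow>
     simple_graph K \<and> card (verts K) = v \<and> edges K = {e. e \<subseteq> verts K \<and> card e = 2}"

text \<open>This is the cycle \<open>C\<^sub>k\<close> only for \<open>k \<ge> 3\<close>; smaller \<open>k\<close> are irrelevant.\<close>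

definition cycle_graph :: "nat \<Rightarrow> nat sgraph" where
  "cycle_graph k =
     \<lparr> verts = {0..<k}, edges = (\<lambda>i. {i, (i + 1) mod k}) ` {0..<k} \<rparr>"

definition path4 :: "nat sgraph" where
  "path4 = \<lparr> verts = {0, 1, 2, 3}, edges = {{0, 1}, {1, 2}, {2, 3}} \<rparr>"

text \<open>
  \<open>design K \<Gamma> \<B>\<close>: \<open>\<B>\<close> is a \<open>(K, \<Gamma>)\<close>-design. Injectivity of \<open>edges\<close> expresses that
  distinct blocks contribute distinct parts, so that no part is used twice.
\<close>

definition design :: "'a sgraph \<Rightarrow> 'b sgraph \<Rightarrow> 'a sgraph set \<Rightarrow> bool" where
  "design K \<Gamma> \<B> \<longleftrightarrow>
     embeds_in \<Gamma> K \<and>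
     (\<forall>B\<in>\<B>. subgraph B K \<and> isomorphic B \<Gamma>) \<and>
     inj_on edges \<B> \<and> partition_on (edges K) (edges ` \<B>)"

definition down_link ::
  "'a sgraph \<Rightarrow> 'b sgraph \<Rightarrow> 'a sgraph set \<Rightarrow>
   'a sgraph \<Rightarrow> 'c sgraph \<Rightarrow> 'a sgraph set \<Rightarrow> ('a sgraph \<Rightarrow> 'a sgraph) \<Rightarrow> bool" where
  "down_link K \<Gamma> \<B> K' \<Gamma>' \<B>' f \<longleftrightarrow>
     design K \<Gamma> \<B> \<and> design K' \<Gamma>' \<B>' \<and> embeds_in \<Gamma>' \<Gamma> \<and>
     f \<in> \<B> \<rightarrow> \<B>' \<and> (\<forall>B\<in>\<B>. subgraph (f B) B)"

text \<open>
  The vertices of all complete graphs are drawn from one infinite type \<open>'a\<close>, passed as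
  \<open>TYPE('a)\<close>. Both complete graphs have arbitrary finite vertex sets in \<open>'a\<close>, which
  may overlap in any way. Infinity of \<open>'a\<close> guarantees that complete graphs of every order
  exist and that fresh vertices are always available.
\<close>

definition admissible :: "'a::infinite itself \<Rightarrow> 'b sgraph \<Rightarrow> nat \<Rightarrow> bool" where
  "admissible T \<Gamma> v \<longleftrightarrow>
     (\<exists>(K :: 'a sgraph) \<B>. complete_of_order v K \<and> design K \<Gamma> \<B>)"

definition L1 :: "'a::infinite itself \<Rightarrow> 'b sgraph \<Rightarrow> nat \<Rightarrow> nat set" where
  "L1 T \<Gamma> v =
     {n. \<exists>(K :: 'a sgraph) \<B>. complete_of_order v K \<and> design K \<Gamma> \<B> \<and>
           (\<exists>K' \<B>' f. complete_of_order n K' \<and> down_link K \<Gamma> \<B> K' path4 \<B>' f)}"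

definition L2 :: "'a::infinite itself \<Rightarrow> 'b sgraph \<Rightarrow> nat \<Rightarrow> nat set" where
  "L2 T \<Gamma> v =
     {n. \<forall>(K :: 'a sgraph) \<B>. complete_of_order v K \<and> design K \<Gamma> \<B> \<longrightarrow>
           (\<exists>K' \<B>' f. complete_of_order n K' \<and> down_link K \<Gamma> \<B> K' path4 \<B>' f)}"

end

theory Submission imports Defs begin

text \<open>
  Put \<open>q = \<lfloor>(k - 9) / 4\<rfloor>\<close> and discard any \<open>q + 2\<close> of the \<open>v\<close> vertices. Each discarded
  vertex spoils at most four of the \<open>k\<close> paths \<open>P\<^sub>4\<close> of a cycle \<open>C\<^sub>k\<close>, and \<open>4 (q + 2) < k\<close>, so every
  block contains a \<open>P\<^sub>4\<close> on the remaining \<open>v - q - 2\<close> vertices. Since \<open>n \<ge> v - q\<close>, passing to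
  \<open>K\<^sub>n\<close> adds at least two new vertices \<open>a\<close>, \<open>b\<close>, and the edges of \<open>K\<^sub>n\<close> not used by the chosen
  paths form the join of the edge \<open>ab\<close> with some graph \<open>G\<close>. Such a join is \<open>P\<^sub>4\<close>-decomposable as
  soon as \<open>3\<close> divides its number of edges and \<open>G\<close> has at least two vertices: remove copies of \<open>P\<^sub>4\<close>
  from \<open>G\<close> until its components are triangles and stars, then remove triangles and pairs of leaves
  of a common star, each together with its edges to \<open>a\<close> and \<open>b\<close>. What remains is a matching with
  isolated vertices, where any three components can be removed at once.
\<close>

section \<open>Decompositions into paths with four vertices\<close>

abbreviation pairs :: "'a set \<Rightarrow> 'a set set" where
  "pairs M \<equiv> {e. e \<subseteq> M \<and> card e = 2}"

definition path_edges :: "'a \<Rightarrow> 'a \<Rightarrow> 'a \<Rightarrow> 'a \<Rightarrow> 'a set set" where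
  "path_edges w x y z = {{w, x}, {x, y}, {y, z}}"

text \<open>Only edge sets are recorded, so one edge set may be regarded as a join in several ways
  and isolated vertices never matter. Vertex sets of blocks return in
  \<open>P4_decomposable_extend\<close>.\<close>

inductive P4_decomposable :: "'a set set \<Rightarrow> bool" where
  empty: "P4_decomposable {}"
| step: "distinct [w, x, y, z] \<Longrightarrow> path_edges w x y z \<inter> S = {} \<Longrightarrow> P4_decomposable S
    \<Longrightarrow> P4_decomposable (path_edges w x y z \<union> S)"

lemma P4_decomposable_Un:
  assumes "P4_decomposable S" "P4_decomposable T" "S \<inter> T = {}"
  shows "P4_decomposable (S \<union> T)"
  using assms
proof (induction rule: P4_decomposable.induct)
  case empty
  then show ?case by simp
next
  case (step w x y z S)
  have "P4_decomposable (path_edges w x y z \<union> (S \<union> T))"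
    using step.hyps(1)
  proof (rule P4_decomposable.step)
    show "path_edges w x y z \<inter> (S \<union> T) = {}"
      using step.hyps(2) step.prems(2) by blast
    show "P4_decomposable (S \<union> T)"
      using step.IH step.prems by blast
  qed
  then show ?case by (simp add: Un_assoc)
qed

fun path_list :: "'a list \<Rightarrow> 'a set list" where
  "path_list (x # y # xs) = {x, y} # path_list (y # xs)"
| "path_list xs = []"

text \<open>Reduces every explicit decomposition to a finite check: distinctness of the concatenated
  edge list rules out that two paths share an edge.\<close>

lemma P4_decomposable_lists:
  assumes "\<forall>p \<in> set ps. distinct p \<and> length p = 4"
    and "distinct (concat (map path_list ps))"
  shows "P4_decomposable (set (concat (map path_list ps)))"
  using assms
proof (induction ps)
  case Nil
  then show ?case by (simp add: P4_decomposable.empty)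
next
  case (Cons p ps)
  have "distinct p \<and> length p = 4" using Cons.prems(1) by (meson list.set_intros(1))
  then obtain w x y z where p: "p = [w, x, y, z]" "distinct [w, x, y, z]"
    by (auto simp: length_Suc_conv numeral_eq_Suc)
  have e: "set (path_list p) = path_edges w x y z"
    by (simp add: p(1) path_edges_def)
  have "P4_decomposable (path_edges w x y z \<union> set (concat (map path_list ps)))"
    using p(2)
  proof (rule P4_decomposable.step)
    show "path_edges w x y z \<inter> set (concat (map path_list ps)) = {}"
      using Cons.prems(2) unfolding e[symmetric] by simp
    show "P4_decomposable (set (concat (map path_list ps)))"
    proof (rule Cons.IH)
      show "\<forall>p \<in> set ps. distinct p \<and> length p = 4"
        using Cons.prems(1) by (meson list.set_intros(2))
      show "distinct (concat (map path_list ps))"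
        using Cons.prems(2) by simp
    qed
  qed
  then show ?case unfolding e[symmetric] by simp
qed

section \<open>Joining a graph with two vertices\<close>

text \<open>\<open>M\<close> holds only the vertices joined to \<open>a\<close> and
  \<open>b\<close>, and \<open>E\<close> may leave \<open>M\<close>. Thus \<open>{a, b}\<close> may
  belong to \<open>E\<close>, and two leaves of a star can form \<open>M\<close> while its centre
  stays outside.\<close>

definition join2 :: "'a \<Rightarrow> 'a \<Rightarrow> 'a set \<Rightarrow> 'a set set \<Rightarrow> 'a set set" where
  "join2 a b M E = E \<union> (\<lambda>x. {a, x}) ` M \<union> (\<lambda>x. {b, x}) ` M"

text \<open>Each edge from \<open>a\<close> or \<open>b\<close> to \<open>M\<close> goes with its
  end in \<open>M\<close>, each edge of \<open>E\<close> with \<open>F\<close> or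
  \<open>E - F\<close>. The last hypothesis keeps these two kinds of edges apart, so the pieces are
  disjoint.\<close>

lemma P4_decomposable_join2_remove:
  assumes "P4_decomposable (join2 a b X F)" "P4_decomposable (join2 a b (M - X) (E - F))"
    and "X \<subseteq> M" "F \<subseteq> E" "a \<noteq> b" "a \<notin> M" "b \<notin> M"
    and "\<And>x. x \<in> M \<Longrightarrow> {a, x} \<notin> E \<and> {b, x} \<notin> E"
  shows "P4_decomposable (join2 a b M E)"
proof -
  have "join2 a b M E = join2 a b X F \<union> join2 a b (M - X) (E - F)"
    using assms(3,4) unfolding join2_def by blast
  moreover have "join2 a b X F \<inter> join2 a b (M - X) (E - F) = {}"
    using assms(3-) unfolding join2_def by (auto simp: doubleton_eq_iff)
  ultimately show ?thesis
    using assms(1,2) by (simp add: P4_decomposable_Un)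
qed

section \<open>Explicit decompositions of small joins\<close>

lemma join2_three_vertices:
  assumes "distinct [a, b, x, y, z]"
  shows "P4_decomposable (join2 a b {x, y, z} {})"
proof -
  let ?ps = "[[a, x, b, y], [y, a, z, b]]"
  have "P4_decomposable (set (concat (map path_list ?ps)))"
    by (rule P4_decomposable_lists) (use assms in \<open>auto simp: doubleton_eq_iff\<close>)
  moreover have "set (concat (map path_list ?ps)) = join2 a b {x, y, z} {}"
    by (auto simp: join2_def insert_commute[of _ _ "{}"])
  ultimately show ?thesis by simp
qed

lemma join2_cherry_leaves:
  assumes "distinct [a, b, x, y, z]"
  shows "P4_decomposable (join2 a b {y, z} {{x, y}, {x, z}})"
proof -
  txt \<open>Both sides are the complete bipartite graph with parts \<open>{y, z}\<close> and \<open>{a, b, x}\<close>.\<close>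
  have "join2 a b {y, z} {{x, y}, {x, z}} = join2 y z {a, b, x} {}"
    by (auto simp: join2_def insert_commute[of _ _ "{}"])
  then show ?thesis
    using join2_three_vertices[of y z a b x] assms by auto
qed

text \<open>Each path goes from \<open>a\<close> to \<open>b\<close> through one edge of the
  triangle; rotating \<open>x\<close>, \<open>y\<close>, \<open>z\<close> permutes the three paths,
  which together use all 3 + 6 edges.\<close>

lemma join2_triangle:
  assumes "distinct [a, b, x, y, z]"
  shows "P4_decomposable (join2 a b {x, y, z} {{x, y}, {y, z}, {x, z}})"
proof -
  let ?ps = "[[a, x, y, b], [a, y, z, b], [a, z, x, b]]"
  have "P4_decomposable (set (concat (map path_list ?ps)))"
    by (rule P4_decomposable_lists) (use assms in \<open>auto simp: doubleton_eq_iff\<close>)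
  moreover have "set (concat (map path_list ?ps)) = join2 a b {x, y, z} {{x, y}, {y, z}, {x, z}}"
    by (auto simp: join2_def insert_commute[of _ _ "{}"])
  ultimately show ?thesis by simp
qed

text \<open>This lemma and the next two, with \<open>join2_three_vertices\<close>, cover all joins
  over three components that are single vertices or single edges.\<close>

lemma join2_edge_two_vertices:
  assumes "distinct [a, b, x, y, u, v]"
  shows "P4_decomposable (join2 a b {x, y, u, v} {{x, y}})"
proof -
  let ?ps = "[[a, x, y, b], [a, u, b, x], [y, a, v, b]]"
  have "P4_decomposable (set (concat (map path_list ?ps)))"
    by (rule P4_decomposable_lists) (use assms in \<open>auto simp: doubleton_eq_iff\<close>)
  moreover have "set (concat (map path_list ?ps)) = join2 a b {x, y, u, v} {{x, y}}"
    by (auto simp: join2_def insert_commute[of _ _ "{}"])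
  ultimately show ?thesis by simp
qed

lemma join2_two_edges_vertex:
  assumes "distinct [a, b, x, y, z, u, v]"
  shows "P4_decomposable (join2 a b {x, y, z, u, v} {{x, y}, {z, u}})"
proof -
  let ?ps = "[[a, x, y, b], [u, z, a, y], [z, b, u, a], [x, b, v, a]]"
  have "P4_decomposable (set (concat (map path_list ?ps)))"
    by (rule P4_decomposable_lists) (use assms in \<open>auto simp: doubleton_eq_iff\<close>)
  moreover have "set (concat (map path_list ?ps)) = join2 a b {x, y, z, u, v} {{x, y}, {z, u}}"
    by (auto simp: join2_def insert_commute[of _ _ "{}"])
  ultimately show ?thesis by simp
qed

lemma join2_three_edges:
  assumes "distinct [a, b, x, y, z, u, s, t]"
  shows "P4_decomposable (join2 a b {x, y, z, u, s, t} {{x, y}, {z, u}, {s, t}})"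
proof -
  let ?ps = "[[a, x, y, b], [u, z, a, y], [t, s, b, x], [z, b, u, a], [s, a, t, b]]"
  have "P4_decomposable (set (concat (map path_list ?ps)))"
    by (rule P4_decomposable_lists) (use assms in \<open>auto simp: doubleton_eq_iff\<close>)
  moreover have "set (concat (map path_list ?ps)) =
      join2 a b {x, y, z, u, s, t} {{x, y}, {z, u}, {s, t}}"
    by (auto simp: join2_def insert_commute[of _ _ "{}"])
  ultimately show ?thesis by simp
qed

text \<open>The join is the complete graph on four vertices, which splits into two Hamiltonian
  paths.\<close>

lemma join2_apex_edge_edge:
  assumes "distinct [a, b, x, y]"
  shows "P4_decomposable (join2 a b {x, y} {{a, b}, {x, y}})"
proof -
  let ?ps = "[[x, a, b, y], [a, y, x, b]]"
  have "P4_decomposable (set (concat (map path_list ?ps)))"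
    by (rule P4_decomposable_lists) (use assms in \<open>auto simp: doubleton_eq_iff\<close>)
  moreover have "set (concat (map path_list ?ps)) = join2 a b {x, y} {{a, b}, {x, y}}"
    by (auto simp: join2_def insert_commute[of _ _ "{}"])
  ultimately show ?thesis by simp
qed

lemma join2_apex_edge_four_vertices:
  assumes "distinct [a, b, x, y, z, u]"
  shows "P4_decomposable (join2 a b {x, y, z, u} {{a, b}})"
proof -
  let ?ps = "[[x, a, b, y], [y, a, z, b], [x, b, u, a]]"
  have "P4_decomposable (set (concat (map path_list ?ps)))"
    by (rule P4_decomposable_lists) (use assms in \<open>auto simp: doubleton_eq_iff\<close>)
  moreover have "set (concat (map path_list ?ps)) = join2 a b {x, y, z, u} {{a, b}}"
    by (auto simp: join2_def insert_commute[of _ _ "{}"])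
  ultimately show ?thesis by simp
qed

text \<open>The roles can be exchanged: \<open>a\<close>, \<open>b\<close>, \<open>x\<close> form a
  triangle, and the nonadjacent vertices \<open>y\<close>, \<open>z\<close> are both joined to all
  of it.\<close>

lemma join2_apex_edge_cherry:
  assumes "distinct [a, b, x, y, z]"
  shows "P4_decomposable (join2 a b {x, y, z} {{a, b}, {x, y}, {x, z}})"
proof -
  have "join2 a b {x, y, z} {{a, b}, {x, y}, {x, z}} = join2 y z {a, b, x} {{a, b}, {b, x}, {a, x}}"
    by (auto simp: join2_def insert_commute[of _ _ "{}"])
  then show ?thesis
    using join2_triangle[of y z a b x] assms by auto
qed

text \<open>An exceptional case: removing the triangle \<open>x\<close>, \<open>y\<close>,
  \<open>z\<close> with its edges to \<open>a\<close> and \<open>b\<close> would leave the triangle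
  \<open>a\<close>, \<open>b\<close>, \<open>u\<close>, which contains no path with four
  vertices.\<close>

lemma join2_apex_edge_triangle_vertex:
  assumes "distinct [a, b, x, y, z, u]"
  shows "P4_decomposable (join2 a b {x, y, z, u} {{a, b}, {x, y}, {y, z}, {x, z}})"
proof -
  let ?ps = "[[u, a, x, y], [u, b, x, z], [y, a, b, z], [a, z, y, b]]"
  have "P4_decomposable (set (concat (map path_list ?ps)))"
    by (rule P4_decomposable_lists) (use assms in \<open>auto simp: doubleton_eq_iff\<close>)
  moreover have "set (concat (map path_list ?ps)) =
      join2 a b {x, y, z, u} {{a, b}, {x, y}, {y, z}, {x, z}}"
    by (auto simp: join2_def insert_commute[of _ _ "{}"])
  ultimately show ?thesis by simp
qed

section \<open>Reducing a graph to a matching\<close>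

lemma pairs_doubletonE:
  assumes "e \<in> pairs M" "x \<in> e"
  obtains y where "e = {x, y}" "x \<noteq> y" "x \<in> M" "y \<in> M"
  using assms by (auto simp: card_2_iff doubleton_eq_iff)

lemma edge_touchingE:
  assumes "E \<subseteq> pairs M" "\<not> E - F \<subseteq> pairs (M - X)"
  obtains u r where "{u, r} \<in> E" "{u, r} \<notin> F" "u \<noteq> r" "u \<in> X"
proof -
  obtain e where e: "e \<in> E" "e \<notin> F" "e \<notin> pairs (M - X)" using assms(2) by blast
  have p: "e \<in> pairs M" using e(1) assms(1) by (rule rev_subsetD)
  then have "\<not> e \<subseteq> M - X" using e(3) by simp
  then obtain u where u: "u \<in> e" "u \<in> X" using p by auto
  from p u(1) obtain r where "e = {u, r}" "u \<noteq> r" by (rule pairs_doubletonE)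
  then show ?thesis using that e u by blast
qed

text \<open>Suppose that edges \<open>{x, y}\<close> and \<open>{x, z}\<close> meet. If
  \<open>{y, z}\<close> is an edge too, a further edge at the triangle extends to a path with four
  vertices; without one the triangle is a component. If \<open>{y, z}\<close> is not an edge, a
  further edge at \<open>y\<close> or \<open>z\<close> gives such a path; without one both are
  leaves at \<open>x\<close>, which may have more neighbours.\<close>

lemma graph_reduction_cases:
  assumes E: "E \<subseteq> pairs M"
  obtains (path) w x y z where "distinct [w, x, y, z]" "path_edges w x y z \<subseteq> E"
  | (triangle) x y z where "distinct [x, y, z]" "{x, y, z} \<subseteq> M"
      "{{x, y}, {y, z}, {x, z}} \<subseteq> E" "E - {{x, y}, {y, z}, {x, z}} \<subseteq> pairs (M - {x, y, z})"
  | (cherry) x y z where "distinct [x, y, z]" "{x, y, z} \<subseteq> M"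
      "{{x, y}, {x, z}} \<subseteq> E" "E - {{x, y}, {x, z}} \<subseteq> pairs (M - {y, z})"
  | (matching) "disjoint E"
proof (cases "disjoint E")
  case True
  then show ?thesis using matching by blast
next
  case False
  then obtain e1 e2 x where e: "e1 \<in> E" "e2 \<in> E" "e1 \<noteq> e2" "x \<in> e1" "x \<in> e2"
    unfolding disjoint_def by blast
  have p: "e1 \<in> pairs M" "e2 \<in> pairs M"
    using rev_subsetD[OF e(1) E] rev_subsetD[OF e(2) E] .
  obtain y where y: "e1 = {x, y}" "x \<noteq> y" "x \<in> M" "y \<in> M"
    using p(1) e(4) by (rule pairs_doubletonE)
  obtain z where z: "e2 = {x, z}" "x \<noteq> z" "x \<in> M" "z \<in> M"
    using p(2) e(5) by (rule pairs_doubletonE)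
  have d: "distinct [x, y, z]" using e y z by auto
  have M: "{x, y, z} \<subseteq> M" using y z by simp
  have in_E: "{x, y} \<in> E" "{x, z} \<in> E" "{y, x} \<in> E" "{z, x} \<in> E"
    using e y(1) z(1) by (simp_all add: insert_commute)
  show ?thesis
  proof (cases "{y, z} \<in> E")
    case True
    show ?thesis
    proof (cases "E - {{x, y}, {y, z}, {x, z}} \<subseteq> pairs (M - {x, y, z})")
      case F: True
      have "{{x, y}, {y, z}, {x, z}} \<subseteq> E" using in_E True by simp
      with d M show ?thesis using F by (rule triangle)
    next
      case F: False
      with E obtain u r where e: "{u, r} \<in> E" "{u, r} \<notin> {{x, y}, {y, z}, {x, z}}"
        "u \<noteq> r" "u \<in> {x, y, z}"
        by (rule edge_touchingE)
      have rn: "r \<noteq> x" "r \<noteq> y" "r \<noteq> z" using e(2-4) by (auto simp: doubleton_eq_iff)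
      have ru: "{r, u} \<in> E" using e(1) by (simp add: insert_commute)
      from e(4) consider "u = x" | "u = y" | "u = z" by blast
      then show ?thesis
      proof cases
        case 1
        show ?thesis
          by (rule path[of r x y z]) (use d rn ru in_E True 1 in \<open>simp_all add: path_edges_def\<close>)
      next
        case 2
        show ?thesis
          by (rule path[of r y x z]) (use d rn ru in_E 2 in \<open>auto simp: path_edges_def\<close>)
      next
        case 3
        show ?thesis
          by (rule path[of r z x y]) (use d rn ru in_E 3 in \<open>auto simp: path_edges_def\<close>)
      qed
    qed
  next
    case False
    show ?thesis
    proof (cases "E - {{x, y}, {x, z}} \<subseteq> pairs (M - {y, z})")
      case F: True
      have "{{x, y}, {x, z}} \<subseteq> E" using in_E by simp
      with d M show ?thesis using F by (rule cherry)
    next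
      case F: False
      with E obtain u r where e: "{u, r} \<in> E" "{u, r} \<notin> {{x, y}, {x, z}}"
        "u \<noteq> r" "u \<in> {y, z}"
        by (rule edge_touchingE)
      \<comment> \<open>Here the absence of \<open>{y, z}\<close> from \<open>E\<close> is what
        forces the other end \<open>r\<close> outside \<open>{x, y, z}\<close>.\<close>
      have "{u, r} \<noteq> {y, z}" using e(1) False by metis
      then have rn: "r \<noteq> x" "r \<noteq> y" "r \<noteq> z" using e(2-4) by (auto simp: doubleton_eq_iff)
      have ru: "{r, u} \<in> E" using e(1) by (simp add: insert_commute)
      from e(4) consider "u = y" | "u = z" by blast
      then show ?thesis
      proof cases
        case 1
        show ?thesis
          by (rule path[of r y x z]) (use d rn ru in_E 1 in \<open>auto simp: path_edges_def\<close>)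
      next
        case 2
        show ?thesis
          by (rule path[of r z x y]) (use d rn ru in_E 2 in \<open>auto simp: path_edges_def\<close>)
      qed
    qed
  qed
qed

section \<open>Matchings, and joins with two nonadjacent vertices\<close>

lemma card_matching:
  assumes "finite M" "E \<subseteq> pairs M" "disjoint E"
  shows "card M = card (M - \<Union>E) + 2 * card E"
proof -
  have "card (\<Union>E) = (\<Sum>e\<in>E. card e)"
  proof (rule card_Union_disjoint)
    show "pairwise disjnt E"
      using assms(3) by (simp add: disjoint_def pairwise_def disjnt_def)
    show "\<And>e. e \<in> E \<Longrightarrow> finite e" using assms(1,2) finite_subset by blast
  qed
  also have "\<dots> = (\<Sum>e\<in>E. 2)"
    by (rule sum.cong) (use assms in auto)
  finally have "card (\<Union>E) = 2 * card E" by simp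
  moreover have "\<Union>E \<subseteq> M" using assms by auto
  ultimately show ?thesis
    using assms(1) by (metis add.commute card_Diff_subset card_mono finite_subset le_add_diff_inverse)
qed

lemma matching_remove:
  assumes "E \<subseteq> pairs M" "disjoint E" "F \<subseteq> E" "J \<inter> \<Union>E = {}" "X = \<Union>F \<union> J"
  shows "E - F \<subseteq> pairs (M - X)"
proof
  fix e assume e: "e \<in> E - F"
  have "e \<inter> f = {}" if "f \<in> F" for f
    by (rule disjointD[OF assms(2)]) (use that e assms(3) in auto)
  then have "e \<inter> \<Union>F = {}" by blast
  moreover have "e \<inter> J = {}" using e assms(4) by blast
  ultimately have "e \<inter> X = {}" unfolding assms(5) by blast
  moreover have "e \<in> pairs M" using e assms(1) by blast
  ultimately show "e \<in> pairs (M - X)" by blast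
qed

lemma three_elements:
  assumes "card A \<ge> 3"
  obtains x y z where "distinct [x, y, z]" "{x, y, z} \<subseteq> A"
proof -
  obtain B where "B \<subseteq> A" "card B = 3" using obtain_subset_with_card_n[OF assms] by metis
  then show ?thesis using that by (auto simp: card_3_iff)
qed

lemma two_elements:
  assumes "card A \<ge> 2"
  obtains x y where "x \<noteq> y" "{x, y} \<subseteq> A"
proof -
  obtain B where "B \<subseteq> A" "card B = 2" using obtain_subset_with_card_n[OF assms] by metis
  then show ?thesis using that by (auto simp: card_2_iff)
qed

lemma matching_edges_distinct:
  assumes "E \<subseteq> pairs M" "disjoint E" "{x, y} \<in> E" "{z, u} \<in> E" "{x, y} \<noteq> {z, u}"
  shows "distinct [x, y, z, u]"
proof -
  have "{x, y} \<inter> {z, u} = {}" using assms(2-5) by (rule disjointD)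
  moreover have "card {x, y} = 2" "card {z, u} = 2" using assms by auto
  ultimately show ?thesis by (auto simp: card_2_iff)
qed

text \<open>An isolated vertex accounts for 2 edges of the join and a matching edge for 1 + 4 = 5,
  both 2 modulo 3. So the number of components is a multiple of 3, and removing any three of them
  preserves the divisibility.\<close>

lemma matching_piece:
  assumes "finite M" "E \<subseteq> pairs M" "disjoint E" "3 dvd card E + 2 * card M" "M \<noteq> {}"
    and ab: "a \<noteq> b" "a \<notin> M" "b \<notin> M"
  obtains X F where "X \<subseteq> M" "F \<subseteq> E" "X \<noteq> {}" "3 dvd card F + 2 * card X"
    "E - F \<subseteq> pairs (M - X)" "P4_decomposable (join2 a b X F)"
proof -
  let ?I = "M - \<Union>E"
  have sub: "e \<subseteq> M" "card e = 2" if "e \<in> E" for e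
    using subsetD[OF assms(2) that] by simp_all
  have finE: "finite E" using assms(1,2) by (simp add: finite_subset)
  have cM: "card M = card ?I + 2 * card E" by (rule card_matching) fact+
  moreover have "card M > 0" using assms by (simp add: card_gt_0_iff)
  \<comment> \<open>By \<open>cM\<close> the divisor 3 divides 5 \<open>card E\<close> + 2
    \<open>card ?I\<close>, hence also \<open>card ?I + card E\<close>, which is positive.\<close>
  ultimately have c3: "card ?I + card E \<ge> 3" using assms(4) by presburger
  \<comment> \<open>Edges are taken first, and isolated vertices fill up to three
    components.\<close>
  consider "card E \<ge> 3" | "card E = 2" | "card E = 1" | "card E = 0" by linarith
  then show ?thesis
  proof cases
    case 1
    then obtain e1 e2 e3 where e: "distinct [e1, e2, e3]" "{e1, e2, e3} \<subseteq> E"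
      by (rule three_elements)
    then have "card e1 = 2" "card e2 = 2" "card e3 = 2" by (simp_all add: sub)
    then obtain x y z u s t where xy: "e1 = {x, y}" "e2 = {z, u}" "e3 = {s, t}"
      by (metis card_2_iff)
    have d: "distinct [x, y, z, u, s, t]"
      using matching_edges_distinct[OF assms(2,3), of x y z u]
        matching_edges_distinct[OF assms(2,3), of x y s t]
        matching_edges_distinct[OF assms(2,3), of z u s t] e xy by simp
    have M: "{x, y, z, u, s, t} \<subseteq> M"
      using sub(1)[of e1] sub(1)[of e2] sub(1)[of e3] e(2) xy by simp
    show ?thesis
    proof (rule that[of "{x, y, z, u, s, t}" "{{x, y}, {z, u}, {s, t}}"])
      show "E - {{x, y}, {z, u}, {s, t}} \<subseteq> pairs (M - {x, y, z, u, s, t})"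
        by (rule matching_remove[OF assms(2,3), of _ "{}"]) (use e xy in auto)
      show "P4_decomposable (join2 a b {x, y, z, u, s, t} {{x, y}, {z, u}, {s, t}})"
        by (rule join2_three_edges) (use d M ab in auto)
      show "3 dvd card {{x, y}, {z, u}, {s, t}} + 2 * card {x, y, z, u, s, t}"
        using d by (auto simp: doubleton_eq_iff card_insert_if)
    qed (use e xy M in auto)
  next
    case 2
    then obtain e1 e2 where e: "E = {e1, e2}" "e1 \<noteq> e2" by (auto simp: card_2_iff)
    then have "card e1 = 2" "card e2 = 2" by (simp_all add: sub)
    then obtain x y z u where xy: "e1 = {x, y}" "e2 = {z, u}"
      by (metis card_2_iff)
    have "?I \<noteq> {}" using c3 2 by force
    then obtain v where v: "v \<in> ?I" by auto
    have d: "distinct [x, y, z, u, v]"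
      using matching_edges_distinct[OF assms(2,3), of x y z u] e xy v by auto
    have M: "{x, y, z, u, v} \<subseteq> M"
      using sub(1)[of e1] sub(1)[of e2] e(1) xy v by simp
    show ?thesis
    proof (rule that[of "{x, y, z, u, v}" "{{x, y}, {z, u}}"])
      show "E - {{x, y}, {z, u}} \<subseteq> pairs (M - {x, y, z, u, v})"
        by (rule matching_remove[OF assms(2,3), of _ "{v}"]) (use e xy v in auto)
      show "P4_decomposable (join2 a b {x, y, z, u, v} {{x, y}, {z, u}})"
        by (rule join2_two_edges_vertex) (use d M ab in auto)
      show "3 dvd card {{x, y}, {z, u}} + 2 * card {x, y, z, u, v}"
        using d by (auto simp: doubleton_eq_iff card_insert_if)
    qed (use e xy M in auto)
  next
    case 3
    then obtain e1 where e: "E = {e1}" by (auto simp: card_1_singleton_iff)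
    then have "card e1 = 2" by (simp add: sub)
    then obtain x y where xy: "e1 = {x, y}" "x \<noteq> y" by (metis card_2_iff)
    have "card ?I \<ge> 2" using c3 3 by linarith
    then obtain u v where v: "u \<noteq> v" "{u, v} \<subseteq> ?I" by (rule two_elements)
    have d: "distinct [x, y, u, v]" using e xy v by auto
    have M: "{x, y, u, v} \<subseteq> M"
      using sub(1)[of e1] e xy v by simp
    show ?thesis
    proof (rule that[of "{x, y, u, v}" "{{x, y}}"])
      show "E - {{x, y}} \<subseteq> pairs (M - {x, y, u, v})"
        by (rule matching_remove[OF assms(2,3), of _ "{u, v}"]) (use e xy v in auto)
      show "P4_decomposable (join2 a b {x, y, u, v} {{x, y}})"
        by (rule join2_edge_two_vertices) (use d M ab in auto)
      show "3 dvd card {{x, y}} + 2 * card {x, y, u, v}"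
        using d by (auto simp: doubleton_eq_iff card_insert_if)
    qed (use e xy M in auto)
  next
    case 4
    then have E0: "E = {}" using finE by simp
    have "card M \<ge> 3" using c3 4 cM by linarith
    then obtain x y z where d: "distinct [x, y, z]" "{x, y, z} \<subseteq> M" by (rule three_elements)
    show ?thesis
    proof (rule that[of "{x, y, z}" "{}"])
      show "P4_decomposable (join2 a b {x, y, z} {})"
        by (rule join2_three_vertices) (use d ab in auto)
    qed (use d E0 in auto)
  qed
qed

lemma card_Diff_add:
  assumes "finite A" "B \<subseteq> A"
  shows "card A = card B + card (A - B)"
  using assms by (metis card_Diff_subset card_mono finite_subset le_add_diff_inverse)

text \<open>The induction measure counts edges as well as vertices because removing a path from
  \<open>E\<close> leaves \<open>M\<close> unchanged.\<close>

lemma join2_decomposable: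
  assumes "finite M" "E \<subseteq> pairs M" "3 dvd card E + 2 * card M"
    and "a \<noteq> b" "a \<notin> M" "b \<notin> M"
  shows "P4_decomposable (join2 a b M E)"
  using assms
proof (induction "card E + card M" arbitrary: M E rule: less_induct)
  case less
  note prems = less.prems
  have finE: "finite E" using prems(1,2) by (simp add: finite_subset)
  \<comment> \<open>The induction step shared by all cases: a decomposable piece whose edge number
    is divisible by 3 may be split off.\<close>
  have reduce: ?case
    if "P4_decomposable (join2 a b X F)" "X \<subseteq> M" "F \<subseteq> E" "X \<noteq> {} \<or> F \<noteq> {}"
      "3 dvd card F + 2 * card X" "E - F \<subseteq> pairs (M - X)" for X F
  proof (rule P4_decomposable_join2_remove[of a b X F])
    have cM: "card M = card X + card (M - X)" using prems(1) that(2) by (rule card_Diff_add)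
    have cE: "card E = card F + card (E - F)" using finE that(3) by (rule card_Diff_add)
    have "card X + card F > 0"
      using that(4) finite_subset[OF that(2) prems(1)] finite_subset[OF that(3) finE]
      by (auto simp: card_gt_0_iff)
    show "P4_decomposable (join2 a b (M - X) (E - F))"
    proof (rule less.hyps)
      show "card (E - F) + card (M - X) < card E + card M"
        using cM cE \<open>card X + card F > 0\<close> by linarith
      show "3 dvd card (E - F) + 2 * card (M - X)"
        using cM cE prems(3) that(5) by presburger
    qed (use prems that in auto)
    show "\<And>x. x \<in> M \<Longrightarrow> {a, x} \<notin> E \<and> {b, x} \<notin> E" using prems by auto
  qed (use that prems in auto)
  from prems(2) show ?case
  proof (cases rule: graph_reduction_cases)
    case (path w x y z)
    \<comment> \<open>With no vertices removed, the piece is the path itself.\<close>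
    have "P4_decomposable (join2 a b {} (path_edges w x y z))"
      using P4_decomposable.step[OF path(1) _ P4_decomposable.empty] by (simp add: join2_def)
    moreover have "card (path_edges w x y z) = 3"
      using path(1) by (auto simp: path_edges_def doubleton_eq_iff card_insert_if)
    ultimately show ?thesis
      using reduce[of "{}" "path_edges w x y z"] path prems(2) by (auto simp: path_edges_def)
  next
    case (triangle x y z)
    show ?thesis
    proof (rule reduce)
      show "P4_decomposable (join2 a b {x, y, z} {{x, y}, {y, z}, {x, z}})"
        by (rule join2_triangle) (use triangle(1,2) prems(4-6) in auto)
      show "3 dvd card {{x, y}, {y, z}, {x, z}} + 2 * card {x, y, z}"
        using triangle(1) by (auto simp: doubleton_eq_iff card_insert_if)
    qed (use triangle in simp_all)
  next
    case (cherry x y z)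
    show ?thesis
    proof (rule reduce)
      show "P4_decomposable (join2 a b {y, z} {{x, y}, {x, z}})"
        by (rule join2_cherry_leaves) (use cherry(1,2) prems(4-6) in auto)
      show "3 dvd card {{x, y}, {x, z}} + 2 * card {y, z}"
        using cherry(1) by (auto simp: doubleton_eq_iff card_insert_if)
    qed (use cherry in simp_all)
  next
    case matching
    show ?thesis
    proof (cases "M = {}")
      case True
      then have "E = {}" using prems(2) by auto
      then show ?thesis using True by (simp add: join2_def P4_decomposable.empty)
    next
      case False
      show ?thesis
        by (rule matching_piece[OF prems(1,2) matching prems(3) False prems(4-6)])
          (rule reduce; simp)
    qed
  qed
qed

section \<open>Joins with two adjacent vertices\<close>

lemma pairs_empty:
  assumes "finite M" "card M \<le> 1"
  shows "pairs M = {}"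
proof -
  have "e \<notin> pairs M" for e
    using card_mono[OF assms(1), of e] assms(2) by simp linarith
  then show ?thesis by blast
qed

text \<open>For a single vertex the join would be a triangle, so the induction must keep
  \<open>card M\<close> at least 2. Pieces are removed as before while this bound survives;
  otherwise a small join that uses up \<open>{a, b}\<close> ends the argument.\<close>

lemma join2_apex_edge_decomposable:
  assumes "finite M" "E \<subseteq> pairs M" "card M \<ge> 2" "3 dvd card E + 2 * card M + 1"
    and "a \<noteq> b" "a \<notin> M" "b \<notin> M"
  shows "P4_decomposable (join2 a b M (insert {a, b} E))"
  using assms
proof (induction "card E + card M" arbitrary: M E rule: less_induct)
  case less
  note prems = less.prems
  have finE: "finite E" using prems(1,2) by (simp add: finite_subset)
  have notE: "{a, x} \<notin> E" "{b, x} \<notin> E" "{x, a} \<notin> E" "{x, b} \<notin> E" for x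
    using prems(2,6,7) by auto
  have star: "x \<in> M \<Longrightarrow> {a, x} \<notin> insert {a, b} E \<and> {b, x} \<notin> insert {a, b} E" for x
    using notE prems(6,7) by (auto simp: doubleton_eq_iff)
  have cM: "card M = card X + card (M - X)" if "X \<subseteq> M" for X
    using prems(1) that by (rule card_Diff_add)
  have cE: "card E = card F + card (E - F)" if "F \<subseteq> E" for F
    using finE that by (rule card_Diff_add)
  have reduce: ?case
    if "P4_decomposable (join2 a b X F)" "X \<subseteq> M" "F \<subseteq> E" "X \<noteq> {} \<or> F \<noteq> {}"
      "3 dvd card F + 2 * card X" "E - F \<subseteq> pairs (M - X)" "card (M - X) \<ge> 2" for X F
  proof (rule P4_decomposable_join2_remove[of a b X F])
    have "card X + card F > 0"
      using that(4) finite_subset[OF that(2) prems(1)] finite_subset[OF that(3) finE]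
      by (auto simp: card_gt_0_iff)
    have "P4_decomposable (join2 a b (M - X) (insert {a, b} (E - F)))"
    proof (rule less.hyps)
      show "card (E - F) + card (M - X) < card E + card M"
        using cM[OF that(2)] cE[OF that(3)] \<open>card X + card F > 0\<close> by linarith
      show "3 dvd card (E - F) + 2 * card (M - X) + 1"
        using cM[OF that(2)] cE[OF that(3)] prems(4) that(5) by presburger
    qed (use prems that in auto)
    moreover have "insert {a, b} E - F = insert {a, b} (E - F)" using notE that(3) by blast
    ultimately show "P4_decomposable (join2 a b (M - X) (insert {a, b} E - F))" by simp
  qed (use that prems star in auto)
  \<comment> \<open>Once \<open>{a, b}\<close> is used up together with \<open>X\<close> and
    \<open>F\<close>, the rest is a join with nonadjacent \<open>a\<close> and \<open>b\<close>,
    where \<open>join2_decomposable\<close> requires no lower bound on the vertices.\<close>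
  have finish: ?case
    if "P4_decomposable (join2 a b X (insert {a, b} F))" "X \<subseteq> M" "F \<subseteq> E"
      "3 dvd card F + 2 * card X + 1" "E - F \<subseteq> pairs (M - X)" for X F
  proof (rule P4_decomposable_join2_remove[of a b X "insert {a, b} F"])
    have "P4_decomposable (join2 a b (M - X) (E - F))"
    proof (rule join2_decomposable)
      show "3 dvd card (E - F) + 2 * card (M - X)"
        using cM[OF that(2)] cE[OF that(3)] prems(4) that(4) by presburger
    qed (use prems that in auto)
    moreover have "insert {a, b} E - insert {a, b} F = E - F" using notE by blast
    ultimately show "P4_decomposable (join2 a b (M - X) (insert {a, b} E - insert {a, b} F))"
      by simp
  qed (use that prems star in auto)
  from prems(2) show ?case
  proof (cases rule: graph_reduction_cases)
    case (path w x y z)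
    have "P4_decomposable (join2 a b {} (path_edges w x y z))"
      using P4_decomposable.step[OF path(1) _ P4_decomposable.empty] by (simp add: join2_def)
    moreover have "card (path_edges w x y z) = 3"
      using path(1) by (auto simp: path_edges_def doubleton_eq_iff card_insert_if)
    ultimately show ?thesis
      using reduce[of "{}" "path_edges w x y z"] path prems(2,3) by (auto simp: path_edges_def)
  next
    case (triangle x y z)
    let ?X = "{x, y, z}" and ?F = "{{x, y}, {y, z}, {x, z}}"
    have card: "card ?X = 3" "card ?F = 3"
      using triangle(1) by (auto simp: doubleton_eq_iff card_insert_if)
    show ?thesis
    proof (cases "card (M - ?X) \<ge> 2")
      case True
      show ?thesis
      proof (rule reduce)
        show "P4_decomposable (join2 a b ?X ?F)"
          by (rule join2_triangle) (use triangle(1,2) prems(5-7) in auto)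
      qed (use triangle card True in simp_all)
    next
      case False
      then have "pairs (M - ?X) = {}" using prems(1) by (intro pairs_empty) simp_all
      then have "E - ?F = {}" using triangle(4) by blast
      then have E: "E = ?F" using triangle(3) by blast
      have "card E = 3" using card(2) unfolding E .
      \<comment> \<open>With no vertex outside the triangle the join would have 3 + 6 + 1 = 10
        edges.\<close>
      then have "card (M - ?X) \<noteq> 0"
        using prems(4) cM[OF triangle(2)] card(1) by presburger
      then have "card (M - ?X) = 1" using False by linarith
      then obtain u where u: "M - ?X = {u}" by (auto simp: card_1_singleton_iff)
      have M: "M = {x, y, z, u}" using u triangle(2) by blast
      have "u \<notin> ?X" using u by blast
      have "P4_decomposable (join2 a b {x, y, z, u} {{a, b}, {x, y}, {y, z}, {x, z}})"
        by (rule join2_apex_edge_triangle_vertex)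
          (use triangle(1,2) \<open>u \<notin> ?X\<close> M prems(5-7) in auto)
      then show ?thesis unfolding M E .
    qed
  next
    case (cherry x y z)
    let ?X = "{y, z}" and ?F = "{{x, y}, {x, z}}"
    have card: "card ?X = 2" "card ?F = 2"
      using cherry(1) by (auto simp: doubleton_eq_iff card_insert_if)
    show ?thesis
    proof (cases "card (M - ?X) \<ge> 2")
      case True
      show ?thesis
      proof (rule reduce)
        show "P4_decomposable (join2 a b ?X ?F)"
          by (rule join2_cherry_leaves) (use cherry(1,2) prems(5-7) in auto)
      qed (use cherry card True in simp_all)
    next
      case False
      then have "pairs (M - ?X) = {}" using prems(1) by (intro pairs_empty) simp_all
      then have "E - ?F = {}" using cherry(4) by blast
      then have E: "E = ?F" using cherry(3) by blast
      \<comment> \<open>The centre of the cherry is not removed, so it must be the only vertex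
        left.\<close>
      have x: "x \<in> M - ?X" using cherry(1,2) by auto
      then have "card (M - ?X) > 0" using prems(1) by (simp only: card_gt_0_iff finite_Diff) blast
      then have "card (M - ?X) = 1" using False by linarith
      then obtain u where "M - ?X = {u}" by (rule card_1_singletonE)
      then have "M - ?X = {x}" using x by simp
      then have M: "M = {x, y, z}" using cherry(2) by blast
      have "P4_decomposable (join2 a b {x, y, z} {{a, b}, {x, y}, {x, z}})"
        by (rule join2_apex_edge_cherry) (use cherry(1,2) prems(5-7) in auto)
      then show ?thesis unfolding M E .
    qed
  next
    case matching
    show ?thesis
    proof (cases "E = {}")
      case True
      \<comment> \<open>For empty \<open>E\<close> the divisibility says that \<open>card M\<close>
        is 1 modulo 3.\<close>
      then have "card M \<ge> 4" using prems(3,4) by (simp; presburger)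
      then obtain N where N: "N \<subseteq> M" "card N = 4"
        using obtain_subset_with_card_n by metis
      then obtain x y z u where d: "N = {x, y, z, u}" "distinct [x, y, z, u]"
        by (auto simp: card_Suc_eq numeral_eq_Suc)
      have "P4_decomposable (join2 a b N {{a, b}})"
        unfolding d(1) by (rule join2_apex_edge_four_vertices) (use d N prems(5-7) in auto)
      then show ?thesis using finish[of N "{}"] True N by simp
    next
      case False
      then obtain e where e: "e \<in> E" by blast
      then have "card e = 2" using prems(2) by auto
      then obtain x y where xy: "e = {x, y}" "x \<noteq> y" by (auto simp: card_2_iff)
      have M: "{x, y} \<subseteq> M" using e xy(1) prems(2) by auto
      \<comment> \<open>Any matching edge forms a complete graph on four vertices with
        \<open>a\<close> and \<open>b\<close>, which uses up \<open>{a, b}\<close>.\<close>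
      show ?thesis
      proof (rule finish)
        show "P4_decomposable (join2 a b {x, y} {{a, b}, {x, y}})"
          by (rule join2_apex_edge_edge) (use xy M prems(5-7) in auto)
        show "E - {{x, y}} \<subseteq> pairs (M - {x, y})"
          by (rule matching_remove[OF prems(2) matching, of _ "{}"]) (use e xy in auto)
      qed (use e xy M in auto)
    qed
  qed
qed

lemma pairs_insert_two:
  assumes "a \<noteq> b" "a \<notin> M" "b \<notin> M" "U \<subseteq> pairs M"
  shows "U \<union> join2 a b M (insert {a, b} (pairs M - U)) = pairs (insert a (insert b M))"
    and "U \<inter> join2 a b M (insert {a, b} (pairs M - U)) = {}"
proof -
  have new: "e \<in> (\<lambda>x. {a, x}) ` M \<union> (\<lambda>x. {b, x}) ` M \<union> {{a, b}}"
    if e: "e \<in> pairs (insert a (insert b M))" "e \<notin> pairs M" for e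
  proof -
    obtain x y where "e = {x, y}" "x \<noteq> y" using e(1) by (auto simp: card_2_iff)
    then show ?thesis using e by auto
  qed
  have "join2 a b M (insert {a, b} (pairs M - U)) \<subseteq> pairs (insert a (insert b M))"
    using assms(1-3) by (auto simp: join2_def card_insert_if)
  moreover have "U \<subseteq> pairs (insert a (insert b M))" using assms(4) by blast
  moreover have "pairs (insert a (insert b M)) \<subseteq> U \<union> join2 a b M (insert {a, b} (pairs M - U))"
  proof
    fix e assume "e \<in> pairs (insert a (insert b M))"
    then show "e \<in> U \<union> join2 a b M (insert {a, b} (pairs M - U))"
      using new[of e] unfolding join2_def by blast
  qed
  ultimately show "U \<union> join2 a b M (insert {a, b} (pairs M - U)) = pairs (insert a (insert b M))"
    by (intro subset_antisym Un_least)
  have "{c, x} \<notin> U" if "c \<notin> M" for c x using that assms(4) by auto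
  then show "U \<inter> join2 a b M (insert {a, b} (pairs M - U)) = {}"
    using assms(2,3) by (auto simp: join2_def)
qed

lemma card_join2_apex_edge:
  assumes "finite M" "E \<subseteq> pairs M" "a \<noteq> b" "a \<notin> M" "b \<notin> M"
  shows "card (join2 a b M (insert {a, b} E)) = card E + 2 * card M + 1"
proof -
  have finE: "finite E" using assms(1,2) by (simp add: finite_subset)
  have inj: "inj_on (\<lambda>x. {c, x}) M" if "c \<notin> M" for c
    using that by (auto simp: inj_on_def doubleton_eq_iff)
  have notE: "{a, x} \<notin> E" "{b, x} \<notin> E" for x
    using assms(2,4,5) by auto
  have "card (insert {a, b} E \<union> (\<lambda>x. {a, x}) ` M) = card E + 1 + card M"
    using assms finE notE by (subst card_Un_disjoint) (auto simp: card_image inj doubleton_eq_iff)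
  then show ?thesis
    unfolding join2_def using assms finE notE
    by (subst card_Un_disjoint) (auto simp: card_image inj doubleton_eq_iff)
qed

section \<open>Cycle designs\<close>

definition path_graph :: "'a \<Rightarrow> 'a \<Rightarrow> 'a \<Rightarrow> 'a \<Rightarrow> 'a sgraph" where
  "path_graph w x y z = \<lparr>verts = {w, x, y, z}, edges = path_edges w x y z\<rparr>"

definition P4_blocks :: "'a sgraph set \<Rightarrow> bool" where
  "P4_blocks \<D> \<longleftrightarrow> (\<forall>B\<in>\<D>. \<exists>w x y z. distinct [w, x, y, z] \<and> B = path_graph w x y z)"

lemma simple_graph_path_graph: "distinct [w, x, y, z] \<Longrightarrow> simple_graph (path_graph w x y z)"
  by (auto simp: simple_graph_def path_graph_def path_edges_def)

lemma isomorphic_path_graph: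
  assumes "distinct [w, x, y, z]"
  shows "isomorphic (path_graph w x y z) path4"
proof -
  have p4: "path4 = path_graph 0 1 2 3"
    by (simp add: path4_def path_graph_def path_edges_def)
  define \<phi> :: "'a \<Rightarrow> nat" where
    "\<phi> v = (if v = w then 0 else if v = x then 1 else if v = y then 2 else 3)" for v
  have \<phi>: "\<phi> w = 0" "\<phi> x = 1" "\<phi> y = 2" "\<phi> z = 3"
    using assms by (auto simp: \<phi>_def)
  have "bij_betw \<phi> {w, x, y, z} {0, 1, 2, 3}"
    by (auto simp: bij_betw_def inj_on_def \<phi>)
  moreover have "path_edges 0 1 2 3 = (\<lambda>e. \<phi> ` e) ` path_edges w x y z"
    by (simp add: path_edges_def \<phi>)
  ultimately show ?thesis
    unfolding isomorphic_def p4 using assms simple_graph_path_graph[of w x y z]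
      simple_graph_path_graph[of "0::nat" 1 2 3]
    by (auto simp: path_graph_def)
qed

lemma verts_path_graph: "verts (path_graph w x y z) = \<Union>(edges (path_graph w x y z))"
  by (auto simp: path_graph_def path_edges_def)

text \<open>A path has no isolated vertex, so its edges determine its vertex set.\<close>

lemma inj_on_edges_P4_blocks: "P4_blocks \<D> \<Longrightarrow> inj_on edges \<D>"
proof (rule inj_onI)
  fix B C assume "P4_blocks \<D>" "B \<in> \<D>" "C \<in> \<D>" and e: "edges B = edges C"
  then have "verts B = \<Union>(edges B)" "verts C = \<Union>(edges C)"
    unfolding P4_blocks_def using verts_path_graph by metis+
  then show "B = C" using e by simp
qed

lemma P4_decomposable_extend:
  assumes "P4_decomposable S" "P4_blocks \<D>" "partition_on U (edges ` \<D>)" "U \<inter> S = {}"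
  shows "\<exists>\<D>'. \<D> \<subseteq> \<D>' \<and> P4_blocks \<D>' \<and> partition_on (U \<union> S) (edges ` \<D>')"
  using assms
proof (induction rule: P4_decomposable.induct)
  case empty
  then show ?case by auto
next
  case (step w x y z S)
  have US: "U \<inter> S = {}" using step.prems(3) by blast
  obtain \<D>' where D: "\<D> \<subseteq> \<D>'" "P4_blocks \<D>'" "partition_on (U \<union> S) (edges ` \<D>')"
    using step.IH[OF step.prems(1,2) US] by blast
  let ?B = "path_graph w x y z"
  have e: "edges ?B = path_edges w x y z" by (simp add: path_graph_def)
  have "disjnt (path_edges w x y z) (\<Union>(edges ` \<D>'))"
    using partition_onD1[OF D(3)] step.hyps(2) step.prems(3) by (auto simp: disjnt_def)
  moreover have "U \<union> S = U \<union> (path_edges w x y z \<union> S) - path_edges w x y z"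
    using step.hyps(2) step.prems(3) by blast
  ultimately have "partition_on (U \<union> (path_edges w x y z \<union> S)) (edges ` insert ?B \<D>')"
    using D(3) by (auto simp: e partition_on_insert path_edges_def)
  moreover have "P4_blocks (insert ?B \<D>')" using D(2) step.hyps(1) unfolding P4_blocks_def by blast
  ultimately show ?case using D(1) by blast
qed

text \<open>A vertex of the cycle lies on exactly those four-vertex stretches that start at its own
  position or at one of the three before it. So \<open>T\<close> excludes at most
  \<open>4 * card T\<close> of the \<open>k\<close> starting positions.\<close>

lemma cycle_avoiding_path:
  assumes iso: "isomorphic B (cycle_graph k)" and "finite T" "4 * card T < k" "k \<ge> 4"
  obtains w x y z where "distinct [w, x, y, z]" "{w, x, y, z} \<subseteq> verts B - T"
    "path_edges w x y z \<subseteq> edges B"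
proof -
  obtain \<phi> where bij: "bij_betw \<phi> (verts B) {0..<k}"
    and edges: "edges (cycle_graph k) = (\<lambda>e. \<phi> ` e) ` edges B" and sB: "simple_graph B"
    using iso by (auto simp: isomorphic_def cycle_graph_def)
  define \<psi> where "\<psi> = inv_into (verts B) \<phi>"
  have \<psi>\<phi>: "\<psi> (\<phi> u) = u" if "u \<in> verts B" for u
    using that bij by (simp add: \<psi>_def bij_betw_inv_into_left)
  have \<phi>\<psi>: "\<phi> (\<psi> i) = i" "\<psi> i \<in> verts B" if "i < k" for i
    using that bij by (auto simp: \<psi>_def bij_betw_inv_into_right bij_betw_def inv_into_into)
  \<comment> \<open>The entry for \<open>(u, j)\<close> is the start of the stretch whose vertex
    number \<open>j\<close> is \<open>u\<close>; adding \<open>k - j\<close> subtracts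
    \<open>j\<close> modulo \<open>k\<close>. For \<open>u\<close> outside \<open>verts B\<close>
    the value \<open>\<phi> u\<close> is arbitrary, but such entries are included in the
    count.\<close>
  define bad where "bad = (\<lambda>(u, j). (\<phi> u + (k - j)) mod k) ` (T \<times> {0..<4})"
  have "card bad \<le> card T * 4"
    unfolding bad_def using card_image_le[of "T \<times> {0..<4::nat}"] assms(2)
    by (simp add: card_cartesian_product)
  then have "card bad < card {0..<k}" using assms(3) by simp
  moreover have "finite bad" using assms(2) by (simp add: bad_def)
  ultimately have "\<not> {0..<k} \<subseteq> bad" using card_mono not_le by blast
  then obtain i where i: "i < k" "i \<notin> bad" by (meson atLeastLessThan_iff subsetI)
  define c where "c j = (i + j) mod k" for j
  have ck: "c j < k" for j using assms(4) by (simp add: c_def)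
  have avoid: "\<psi> (c j) \<notin> T" if "j < 4" for j
  proof
    assume "\<psi> (c j) \<in> T"
    then have "(\<phi> (\<psi> (c j)) + (k - j)) mod k \<in> bad"
      unfolding bad_def using that by force
    moreover have "(\<phi> (\<psi> (c j)) + (k - j)) mod k = (i + j + (k - j)) mod k"
      by (simp add: \<phi>\<psi> ck) (simp add: c_def mod_add_left_eq)
    moreover have "(i + j + (k - j)) mod k = i"
      using that assms(4) i(1) by simp
    ultimately show False using i(2) by simp
  qed
  have edge: "{\<psi> (c j), \<psi> (c (Suc j))} \<in> edges B" for j
  proof -
    have "{c j, c (Suc j)} \<in> edges (cycle_graph k)"
      unfolding cycle_graph_def using ck[of j]
      by (auto simp: c_def mod_Suc_eq intro!: image_eqI[of _ _ "(i + j) mod k"])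
    then obtain e where e: "e \<in> edges B" "\<phi> ` e = {c j, c (Suc j)}"
      unfolding edges by auto
    then have "e \<subseteq> verts B" using sB by (auto simp: simple_graph_def)
    then have "e = \<psi> ` (\<phi> ` e)" using \<psi>\<phi> by (force simp: image_image)
    then show ?thesis using e by simp
  qed
  \<comment> \<open>Since \<open>i < k\<close> and \<open>j < 4 \<le> k\<close>, the position wraps
    around at most once.\<close>
  have c_eq: "c j = (if i + j < k then i + j else i + j - k)" if "j < 4" for j
    using that i(1) assms(4) by (simp add: c_def le_mod_geq)
  have "distinct [c 0, c 1, c 2, c 3]"
    using i(1) assms(4) by (simp add: c_eq) linarith
  moreover have "\<psi> (c j) = \<psi> (c l) \<Longrightarrow> c j = c l" for j l by (metis \<phi>\<psi>(1) ck)
  ultimately have "distinct [\<psi> (c 0), \<psi> (c 1), \<psi> (c 2), \<psi> (c 3)]" by auto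
  moreover have "{\<psi> (c 0), \<psi> (c 1), \<psi> (c 2), \<psi> (c 3)} \<subseteq> verts B - T"
    using avoid \<phi>\<psi>(2) ck by simp
  moreover have "path_edges (\<psi> (c 0)) (\<psi> (c 1)) (\<psi> (c 2)) (\<psi> (c 3)) \<subseteq> edges B"
    using edge[of 0] edge[of 1] edge[of 2] by (simp add: path_edges_def numeral_eq_Suc)
  ultimately show ?thesis by (rule that)
qed

text \<open>The bound comes from the embedded cycle that \<open>design\<close> demands, not from the
  blocks; it excludes degenerate orders with no blocks at all.\<close>

lemma cycle_design_order:
  assumes "complete_of_order v K" "design K (cycle_graph k) \<B>"
  shows "k \<le> v"
proof -
  obtain H \<phi> where "subgraph H K" "bij_betw \<phi> (verts H) {0..<k}"
    using assms(2) by (auto simp: design_def embeds_in_def isomorphic_def cycle_graph_def)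
  then have "card (verts H) = k" "verts H \<subseteq> verts K" "finite (verts K)"
    using bij_betw_same_card by (force simp: subgraph_def simple_graph_def)+
  then show ?thesis
    using assms(1) card_mono by (force simp: complete_of_order_def)
qed

lemma embeds_path4_cycle:
  assumes "k \<ge> 4"
  shows "embeds_in path4 (cycle_graph k)"
proof -
  have p4: "path4 = path_graph 0 1 2 3"
    by (simp add: path4_def path_graph_def path_edges_def)
  have "simple_graph (cycle_graph k)"
    using assms by (auto simp: simple_graph_def cycle_graph_def mod_Suc)
  moreover have "{j, Suc j} \<in> edges (cycle_graph k)" if "j < 3" for j
    unfolding cycle_graph_def using that assms by (auto intro!: image_eqI[of _ _ j])
  from this[of 0] this[of 1] this[of 2] have "edges path4 \<subseteq> edges (cycle_graph k)"
    by (simp add: path4_def numeral_eq_Suc)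
  moreover have "simple_graph path4" unfolding p4 by (rule simple_graph_path_graph) simp
  moreover have "verts path4 \<subseteq> verts (cycle_graph k)"
    using assms by (auto simp: path4_def cycle_graph_def)
  ultimately have "subgraph path4 (cycle_graph k)" by (simp add: subgraph_def)
  moreover have "isomorphic path4 path4"
    using isomorphic_path_graph[of 0 1 2 "3::nat"] by (simp add: p4)
  ultimately show ?thesis unfolding embeds_in_def by blast
qed

section \<open>Constructing the down-link\<close>

lemma three_dvd_choose_two:
  assumes "n mod 3 = 0 \<or> n mod 3 = (1::nat)"
  shows "3 dvd n choose 2"
proof -
  have "2 * (n choose 2) = n * (n - 1)"
    unfolding choose_two by (rule dvd_mult_div_cancel) (cases n; simp)
  moreover have "3 dvd n \<or> 3 dvd n - 1" using assms by presburger
  ultimately have "3 dvd 2 * (n choose 2)" by (metis dvd_mult dvd_mult2)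
  then show ?thesis by presburger
qed

lemma cycle_design_down_link:
  fixes K :: "'a::infinite sgraph"
  assumes "k \<ge> 9" and K: "complete_of_order v K" and design: "design K (cycle_graph k) \<B>"
    and n: "v \<le> n + (k - 9) div 4" "n mod 3 = 0 \<or> n mod 3 = 1"
  shows "\<exists>(K' :: 'a sgraph) \<B>' f. complete_of_order n K' \<and>
    down_link K (cycle_graph k) \<B> K' path4 \<B>' f"
proof -
  let ?q = "(k - 9) div 4"
  have "k \<le> v" using K design by (rule cycle_design_order)
  have finK: "finite (verts K)" "card (verts K) = v" "edges K = pairs (verts K)"
    using K by (auto simp: complete_of_order_def simple_graph_def)
  \<comment> \<open>Discarding \<open>?q + 2\<close> vertices still satisfies
    \<open>4 * (?q + 2) < k\<close>, since \<open>4 * ?q \<le> k - 9\<close>; the extra 2 makes room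
    for \<open>a\<close> and \<open>b\<close>.\<close>
  have "?q + 2 \<le> card (verts K)" using \<open>k \<le> v\<close> \<open>k \<ge> 9\<close> finK(2) by linarith
  then obtain T where T: "T \<subseteq> verts K" "card T = ?q + 2"
    using obtain_subset_with_card_n by metis
  have finT: "finite T" using T(1) finK(1) by (rule finite_subset)
  let ?V = "verts K - T"
  have cV: "card ?V = v - (?q + 2)" using T finT finK by (simp add: card_Diff_subset)

  have "\<exists>P. subgraph P B \<and> verts P \<subseteq> ?V \<and> P4_blocks {P}" if "B \<in> \<B>" for B
  proof -
    have B: "subgraph B K" "isomorphic B (cycle_graph k)"
      using design that by (auto simp: design_def)
    have "4 * card T < k" "k \<ge> 4" using \<open>k \<ge> 9\<close> T(2) by linarith+
    with B(2) finT obtain w x y z where p: "distinct [w, x, y, z]" "{w, x, y, z} \<subseteq> verts B - T"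
        "path_edges w x y z \<subseteq> edges B"
      by (rule cycle_avoiding_path)
    have "subgraph (path_graph w x y z) B"
      unfolding subgraph_def using simple_graph_path_graph[OF p(1)] p B(1)
      by (auto simp: path_graph_def subgraph_def)
    moreover have "verts (path_graph w x y z) \<subseteq> ?V"
      using p(2) B(1) by (auto simp: path_graph_def subgraph_def)
    moreover have "P4_blocks {path_graph w x y z}" using p(1) unfolding P4_blocks_def by blast
    ultimately show ?thesis by blast
  qed
  then obtain f where f: "\<And>B. B \<in> \<B> \<Longrightarrow> subgraph (f B) B"
      "\<And>B. B \<in> \<B> \<Longrightarrow> verts (f B) \<subseteq> ?V" "\<And>B. B \<in> \<B> \<Longrightarrow> P4_blocks {f B}"
    by metis
  have blocks_f: "P4_blocks (f ` \<B>)" using f(3) by (auto simp: P4_blocks_def)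
  define U where "U = \<Union>(edges ` f ` \<B>)"
  have edges_f: "edges (f B) \<subseteq> edges B" "edges (f B) \<subseteq> pairs ?V" if "B \<in> \<B>" for B
    using f(1,2)[OF that] by (auto simp: subgraph_def simple_graph_def)
  have card_f: "card (edges (f B)) = 3" if "B \<in> \<B>" for B
    using f(3)[OF that]
    by (auto simp: P4_blocks_def path_graph_def path_edges_def doubleton_eq_iff card_insert_if)
  have disj_f: "disjoint (edges ` f ` \<B>)"
  proof (rule disjointI)
    fix S S' assume "S \<in> edges ` f ` \<B>" "S' \<in> edges ` f ` \<B>" "S \<noteq> S'"
    then obtain B B' where B: "B \<in> \<B>" "B' \<in> \<B>" "B \<noteq> B'" "S = edges (f B)" "S' = edges (f B')"
      by blast
    \<comment> \<open>The chosen paths inherit edge-disjointness from the blocks containing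
      them.\<close>
    have "edges B \<noteq> edges B'" using B(1-3) design by (auto simp: design_def inj_on_def)
    moreover have "disjoint (edges ` \<B>)" using design by (auto simp: design_def partition_on_def)
    ultimately have "edges B \<inter> edges B' = {}" using B(1,2) by (auto simp: disjoint_def)
    then show "S \<inter> S' = {}" using B edges_f(1) by blast
  qed
  have "{} \<notin> edges ` f ` \<B>" using card_f by force
  then have part_f: "partition_on U (edges ` f ` \<B>)" using disj_f by (simp add: partition_on_def U_def)
  have U: "U \<subseteq> pairs ?V" using edges_f(2) unfolding U_def by blast

  \<comment> \<open>The new vertices need only avoid \<open>?V\<close>; they may include discarded
    ones.\<close>
  have "infinite (UNIV - ?V)" using finK(1) infinite_UNIV by simp
  then obtain W where W: "finite W" "card W = n - card ?V" "W \<subseteq> UNIV - ?V"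
    using infinite_arbitrarily_large by blast
  \<comment> \<open>From \<open>v \<le> n + ?q\<close> and \<open>card ?V = v - (?q + 2)\<close> it
    follows that \<open>n\<close> exceeds \<open>card ?V\<close> by at least 2.\<close>
  have "card W \<ge> 2" using W(2) cV n(1) \<open>?q + 2 \<le> card (verts K)\<close> finK(2) by linarith
  then obtain a b where ab: "a \<noteq> b" "{a, b} \<subseteq> W" by (rule two_elements)
  let ?V' = "?V \<union> W"
  define M where "M = ?V' - {a, b}"
  have finV': "finite ?V'" using finK(1) W(1) by simp
  have "card ?V' = card ?V + card W"
    using W(1,3) finK(1) by (intro card_Un_disjoint) auto
  then have cV': "card ?V' = n"
    using W(2) cV n(1) \<open>?q + 2 \<le> card (verts K)\<close> finK(2) by linarith
  have abV: "a \<notin> ?V" "b \<notin> ?V" using ab W(3) by auto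
  have finM: "finite M" and abM: "a \<notin> M" "b \<notin> M" using finV' by (simp_all add: M_def)
  have cM: "card M = n - 2" unfolding M_def using ab finV' cV' by (subst card_Diff_subset) auto
  define R where "R = join2 a b M (insert {a, b} (pairs M - U))"
  have V'_eq: "?V' = insert a (insert b M)" unfolding M_def using ab by blast
  have "U \<subseteq> pairs M" using U abV unfolding M_def by blast
  then have UR: "U \<union> R = pairs ?V'" and disjUR: "U \<inter> R = {}"
    unfolding R_def V'_eq by (rule pairs_insert_two[OF ab(1) abM])+
  \<comment> \<open>\<open>U\<close> consists of disjoint triples, and the complete graph of order
    \<open>n\<close> has a multiple of 3 edges; hence so does the rest \<open>R\<close>.\<close>
  have "3 dvd card U" unfolding U_def
  proof (rule dvd_partition)
    show "finite (\<Union>(edges ` f ` \<B>))"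
      using finite_subset[OF U[unfolded U_def]] finK(1) by simp
    show "\<forall>S\<in>edges ` f ` \<B>. 3 dvd card S" using card_f by simp
    show "\<forall>S\<in>edges ` f ` \<B>. \<forall>S'\<in>edges ` f ` \<B>. S \<noteq> S' \<longrightarrow> S \<inter> S' = {}"
      using disj_f unfolding disjoint_def .
  qed
  moreover have "card (pairs ?V') = n choose 2" using n_subsets[OF finV', of 2] cV' by simp
  moreover have "card (pairs ?V') = card U + card R"
  proof -
    have "finite (U \<union> R)" unfolding UR using finV' by simp
    then show ?thesis unfolding UR[symmetric] using disjUR by (intro card_Un_disjoint) simp_all
  qed
  ultimately have "3 dvd card R" using three_dvd_choose_two[OF n(2)] by presburger
  moreover have "card R = card (pairs M - U) + 2 * card M + 1"
    unfolding R_def by (rule card_join2_apex_edge) (use finM abM ab in auto)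
  moreover have "card M \<ge> 2" using cM n(1) \<open>k \<le> v\<close> \<open>k \<ge> 9\<close> by linarith
  ultimately have "P4_decomposable R"
    unfolding R_def using finM abM ab(1) by (intro join2_apex_edge_decomposable) auto
  then obtain \<D> where D: "f ` \<B> \<subseteq> \<D>" "P4_blocks \<D>" "partition_on (pairs ?V') (edges ` \<D>)"
    using P4_decomposable_extend[OF _ blocks_f part_f disjUR] unfolding UR by blast

  define K' where "K' = \<lparr>verts = ?V', edges = pairs ?V'\<rparr>"
  have sK': "simple_graph K'" using finV' by (simp add: K'_def simple_graph_def)
  have order: "complete_of_order n K'"
    using sK' cV' by (simp add: complete_of_order_def K'_def)
  have blocks: "subgraph B K'" "isomorphic B path4" if BD: "B \<in> \<D>" for B
  proof -
    obtain w x y z where B: "distinct [w, x, y, z]" "B = path_graph w x y z"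
      using D(2) BD unfolding P4_blocks_def by blast
    have "edges B \<subseteq> pairs ?V'" using partition_onD1[OF D(3)] BD by blast
    moreover from this have "verts B \<subseteq> ?V'"
      unfolding B(2) verts_path_graph by blast
    ultimately show "subgraph B K'"
      using simple_graph_path_graph[OF B(1)] sK' by (simp add: subgraph_def K'_def B(2))
    show "isomorphic B path4" unfolding B(2) using B(1) by (rule isomorphic_path_graph)
  qed
  \<comment> \<open>This edge shows that \<open>\<D>\<close> is nonempty, which yields the embedded
    copy of \<open>path4\<close> that \<open>design\<close> demands.\<close>
  have "{a, b} \<in> pairs ?V'" using ab by auto
  then obtain B where "B \<in> \<D>" using partition_onD1[OF D(3)] by blast
  then have "embeds_in path4 K'" using blocks unfolding embeds_in_def by blast
  then have "design K' path4 \<D>"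
    using blocks inj_on_edges_P4_blocks[OF D(2)] D(3) by (simp add: design_def K'_def)
  moreover have "embeds_in path4 (cycle_graph k)" using \<open>k \<ge> 9\<close> by (intro embeds_path4_cycle) simp
  ultimately have "down_link K (cycle_graph k) \<B> K' path4 \<D> f"
    using design D(1) f(1) by (auto simp: down_link_def)
  then show ?thesis using order by blast
qed

theorem theorem4p1:
  fixes k v :: nat
  assumes "k \<ge> 9"
    and "admissible TYPE('a::infinite) (cycle_graph k) v"
  shows "{n :: nat. int n \<ge> int v - \<lfloor>(real k - 9) / 4\<rfloor> \<and> (n mod 3 = 0 \<or> n mod 3 = 1)}
           \<subseteq> L2 TYPE('a) (cycle_graph k) v
       \<and> L2 TYPE('a) (cycle_graph k) v \<subseteq> L1 TYPE('a) (cycle_graph k) v"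
proof
  \<comment> \<open>As \<open>k \<ge> 9\<close>, the natural subtraction \<open>k - 9\<close> is
    exact, so the real floor becomes a natural quotient.\<close>
  have "(real k - 9) / 4 = real (k - 9) / real 4" using assms(1) by simp
  then have floor: "\<lfloor>(real k - 9) / 4\<rfloor> = int ((k - 9) div 4)"
    by (simp only: floor_divide_of_nat_eq)
  show "{n :: nat. int n \<ge> int v - \<lfloor>(real k - 9) / 4\<rfloor> \<and> (n mod 3 = 0 \<or> n mod 3 = 1)}
      \<subseteq> L2 TYPE('a) (cycle_graph k) v"
  proof
    fix n assume "n \<in> {n :: nat. int n \<ge> int v - \<lfloor>(real k - 9) / 4\<rfloor> \<and> (n mod 3 = 0 \<or> n mod 3 = 1)}"
    then have "v \<le> n + (k - 9) div 4" "n mod 3 = 0 \<or> n mod 3 = 1"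
      unfolding floor by simp_all
    then show "n \<in> L2 TYPE('a) (cycle_graph k) v"
      unfolding L2_def by (intro CollectI allI impI cycle_design_down_link[OF assms(1)]) simp_all
  qed
  \<comment> \<open>Admissibility supplies a design, so the universal statement in \<open>L2\<close>
    is not vacuous.\<close>
  show "L2 TYPE('a) (cycle_graph k) v \<subseteq> L1 TYPE('a) (cycle_graph k) v"
    using assms(2) unfolding L1_def L2_def admissible_def by blast
qed

end
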